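(* Let $(E,w)$ be a weighted $n$-star graph and $\mathcal{M}(E,w)$ its associated weighted graph monoid. Then $\mathcal{M}(E,w)$ is confluent if and only if $(E,w)$ is vertex-weighted.
   Context: $\mathbb N=\{1,2,\dots\}$. A directed graph is $E=(E^0,E^1,s,r)$ with vertex set $E^0$, edge set $E^1$ and source/range maps $s,r:E^1\to E^0$. A vertex $v$ is a sink if $s^{-1}(v)=\varnothing$ and regular if $0<|s^{-1}(v)|<\infty$. A weighted graph $(E,w)$ is a directed graph $E$ with a map $w:E^1\to\mathbb N$. Standing assumption: weighted graphs are nonempty, row-finite ($|s^{-1}(v)|<\infty$ for all $v$) and connected (the underlying undirected graph is connected). $(E,w)$ is vertex-weighted if for every regular $v$ all edges in $s^{-1}(v)$ have the same weight. A star graph is a connected graph $E$ with $E^0=\{u\}\sqcup S$, $S$ nonempty, such that every edge $e$ has $s(e)=u$ and $r(e)\in S$ (multiple edges allowed). By row-finiteness $S$ is finite; with $|S|=n$, $(E,w)$ is called a weighted $n$-star graph with source vertex $u$. For $v\in E^0$ let $w_1(v)<\dots<w_{k_v}(v)$ be the distinct weights of the edges in $s^{-1}(v)$ (so $k_v=0$ for a sink), and put $w_0(v)=0$. Let $\mathcal E=\{v,q_1^v,\dots,q_{k_v-1}^v : v\in E^0\}$ (formal distinct symbols), let $F_{\mathcal E}$ be the free commutative monoid on $\mathcal E$, written additively, and set $q_0^v=q_{k_v}^v=0$ in $F_{\mathcal E}$. For regular $u$ and $\alpha\in w(s^{-1}(u))$ put $\Sigma_\alpha(u)=\sum_{e\in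 s^{-1}(u),\,w(e)=\alpha} r(e)\in F_{\mathcal E}$. Define the reduction relation $\to$ on $F_{\mathcal E}$ by $$y+q_{i-1}^u+(w_i(u)-w_{i-1}(u))u\ \to\ y+q_i^u+\Sigma_{w_i(u)}(u)$$ for all $y\in F_{\mathcal E}$, regular $u$ and $1\le i\le k_u$. Let $\to^*$ be its reflexive-transitive closure and $\sim$ the congruence it generates. The weighted graph monoid is $\mathcal M(E,w)=F_{\mathcal E}/\!\sim$. It is called confluent if for all $a,b\in F_{\mathcal E}$: $a\sim b$ if and only if there is $c\in F_{\mathcal E}$ with $a\to^* c$ and $b\to^* c$. *)

theory Defs
  imports
    "Graph_Theory.Digraph_Component"
    "HOL-Library.Multiset"
    "HOL-Algebra.Group"
begin

section \<open>Weighted graphs\<close>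

definition regular :: "('v, 'e) pre_digraph \<Rightarrow> 'v \<Rightarrow> bool" where
  "regular G v \<longleftrightarrow> v \<in> verts G \<and> finite (out_arcs G v) \<and> out_arcs G v \<noteq> {}"

text \<open>
  The weights are positive integers. Connectedness in the sense of the library refers to the
  underlying undirected graph and includes that the vertex set is nonempty.
\<close>
locale weighted_graph = wf_digraph G
  for G :: "('v, 'e) pre_digraph" and w :: "'e \<Rightarrow> nat" +
  assumes weight_pos: "e \<in> arcs G \<Longrightarrow> 1 \<le> w e"
    and row_finite: "v \<in> verts G \<Longrightarrow> finite (out_arcs G v)"
    and connected: "Digraph_Component.connected G"

definition vertex_weighted :: "('v, 'e) pre_digraph \<Rightarrow> ('e \<Rightarrow> nat) \<Rightarrow> bool" where
  "vertex_weighted G w \<longleftrightarrow>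
     (\<forall>v. regular G v \<longrightarrow> (\<forall>e \<in> out_arcs G v. \<forall>f \<in> out_arcs G v. w e = w f))"

text \<open>
  A weighted \<open>n\<close>-star graph with source vertex \<open>u\<close>; the set \<open>S\<close> of the other vertices is
  \<open>verts G - {u}\<close>. Its finiteness is not assumed, see \<open>finite_S\<close> below.
\<close>
locale weighted_star_graph = weighted_graph G w
  for G :: "('v, 'e) pre_digraph" and w :: "'e \<Rightarrow> nat" +
  fixes u :: 'v and n :: nat
  assumes source_in_verts: "u \<in> verts G"
    and S_nonempty: "verts G - {u} \<noteq> {}"
    and tail_source: "e \<in> arcs G \<Longrightarrow> tail G e = u"
    and head_S: "e \<in> arcs G \<Longrightarrow> head G e \<in> verts G - {u}"
    and card_S: "card (verts G - {u}) = n"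

lemma (in weighted_star_graph) finite_S: "finite (verts G - {u})"
proof -
  have "v \<in> head G ` out_arcs G u" if v: "v \<in> verts G" "v \<noteq> u" for v
  proof -
    have "u \<rightarrow>\<^sup>*\<^bsub>with_proj (mk_symmetric G)\<^esub> v"
      using connected v source_in_verts
      by (auto simp: Digraph_Component.connected_def strongly_connected_def)
    then have "(u, v) \<in> (arcs_ends (with_proj (mk_symmetric G)))\<^sup>*"
      unfolding reachable_def by (rule rtrancl_on_rtranclI)
    then obtain x where "(x, v) \<in> arcs_ends (with_proj (mk_symmetric G))"
      using v(2) by (auto elim: rtranclE)
    then have "(x, v) \<in> parcs (mk_symmetric G)"
      by (auto simp: arcs_ends_conv)
    then obtain e where "e \<in> arcs G" "tail G e = v \<or> head G e = v"
      by (auto simp: parcs_mk_symmetric)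
    then show ?thesis
      using v(2) tail_source[of e] by (auto simp: out_arcs_def)
  qed
  then have "verts G - {u} \<subseteq> head G ` out_arcs G u" by auto
  then show ?thesis
    using row_finite[OF source_in_verts] finite_subset by blast
qed


section \<open>The weighted graph monoid\<close>

text \<open>\<open>num_weights G w v\<close> is $k_v$.\<close>

definition num_weights :: "('v, 'e) pre_digraph \<Rightarrow> ('e \<Rightarrow> nat) \<Rightarrow> 'v \<Rightarrow> nat" where
  "num_weights G w v = card (w ` out_arcs G v)"

text \<open>
  For \<open>1 \<le> i \<le> k\<^sub>v\<close>, \<open>weight_at G w v i\<close> is the \<open>i\<close>-th smallest of the distinct weights of the edges
  emitted by \<open>v\<close>, and \<open>weight_at G w v 0 = 0\<close>; it is unspecified for \<open>i > k\<^sub>v\<close>.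
\<close>
definition weight_at :: "('v, 'e) pre_digraph \<Rightarrow> ('e \<Rightarrow> nat) \<Rightarrow> 'v \<Rightarrow> nat \<Rightarrow> nat" where
  "weight_at G w v i = (0 # sorted_list_of_set (w ` out_arcs G v)) ! i"

datatype 'v generator = Vtx 'v | Q_gen 'v nat

definition generators :: "('v, 'e) pre_digraph \<Rightarrow> ('e \<Rightarrow> nat) \<Rightarrow> 'v generator set" where
  "generators G w =
     Vtx ` verts G \<union> {Q_gen v i | v i. v \<in> verts G \<and> 1 \<le> i \<and> i < num_weights G w v}"

text \<open>The free commutative monoid on the generators, as finite multisets under addition.\<close>

definition free_monoid ::
  "('v, 'e) pre_digraph \<Rightarrow> ('e \<Rightarrow> nat) \<Rightarrow> 'v generator multiset set" where
  "free_monoid G w = {a. set_mset a \<subseteq> generators G w}"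

text \<open>The element $q_i^v$, with the convention that it is zero for \<open>i = 0\<close> and \<open>i = k\<^sub>v\<close>.\<close>

definition q_elem :: "('v, 'e) pre_digraph \<Rightarrow> ('e \<Rightarrow> nat) \<Rightarrow> 'v \<Rightarrow> nat \<Rightarrow> 'v generator multiset" where
  "q_elem G w v i = (if i = 0 \<or> i = num_weights G w v then {#} else {#Q_gen v i#})"

definition range_sum ::
  "('v, 'e) pre_digraph \<Rightarrow> ('e \<Rightarrow> nat) \<Rightarrow> 'v \<Rightarrow> nat \<Rightarrow> 'v generator multiset" where
  "range_sum G w v \<alpha> = (\<Sum>e \<in> {e \<in> out_arcs G v. w e = \<alpha>}. {#Vtx (head G e)#})"

inductive reduces ::
  "('v, 'e) pre_digraph \<Rightarrow> ('e \<Rightarrow> nat) \<Rightarrow>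
   'v generator multiset \<Rightarrow> 'v generator multiset \<Rightarrow> bool"
  for G w where
  "\<lbrakk>y \<in> free_monoid G w; regular G v; 1 \<le> i; i \<le> num_weights G w v\<rbrakk> \<Longrightarrow>
   reduces G w
     (y + q_elem G w v (i - 1) + replicate_mset (weight_at G w v i - weight_at G w v (i - 1)) (Vtx v))
     (y + q_elem G w v i + range_sum G w v (weight_at G w v i))"

text \<open>The congruence on the free monoid generated by the reduction relation.\<close>

inductive weighted_cong ::
  "('v, 'e) pre_digraph \<Rightarrow> ('e \<Rightarrow> nat) \<Rightarrow>
   'v generator multiset \<Rightarrow> 'v generator multiset \<Rightarrow> bool"
  for G w where
  base: "reduces G w a b \<Longrightarrow> weighted_cong G w a b"
| refl: "a \<in> free_monoid G w \<Longrightarrow> weighted_cong G w a a"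
| sym: "weighted_cong G w a b \<Longrightarrow> weighted_cong G w b a"
| trans: "weighted_cong G w a b \<Longrightarrow> weighted_cong G w b c \<Longrightarrow> weighted_cong G w a c"
| add: "weighted_cong G w a b \<Longrightarrow> weighted_cong G w c d \<Longrightarrow> weighted_cong G w (a + c) (b + d)"

definition cong_rel ::
  "('v, 'e) pre_digraph \<Rightarrow> ('e \<Rightarrow> nat) \<Rightarrow>
   ('v generator multiset \<times> 'v generator multiset) set" where
  "cong_rel G w = {(a, b). weighted_cong G w a b}"

text \<open>The weighted graph monoid, written multiplicatively as is usual in the library.\<close>

definition weighted_graph_monoid ::
  "('v, 'e) pre_digraph \<Rightarrow> ('e \<Rightarrow> nat) \<Rightarrow> 'v generator multiset set monoid" where
  "weighted_graph_monoid G w =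
     \<lparr> carrier = free_monoid G w // cong_rel G w,
       monoid.mult = (\<lambda>A B. \<Union>a \<in> A. \<Union>b \<in> B. cong_rel G w `` {a + b}),
       one = cong_rel G w `` {{#}} \<rparr>"

text \<open>
  Confluence of the weighted graph monoid is a property of its presentation rather than of its
  isomorphism class. By \<open>class_eq_iff\<close> below, \<open>weighted_cong G w a b\<close> says that \<open>a\<close> and \<open>b\<close> represent the
  same element of the monoid.
\<close>
definition monoid_confluent :: "('v, 'e) pre_digraph \<Rightarrow> ('e \<Rightarrow> nat) \<Rightarrow> bool" where
  "monoid_confluent G w \<longleftrightarrow>
     (\<forall>a \<in> free_monoid G w. \<forall>b \<in> free_monoid G w.
        weighted_cong G w a b \<longleftrightarrow>
        (\<exists>c \<in> free_monoid G w. (reduces G w)\<^sup>*\<^sup>* a c \<and> (reduces G w)\<^sup>*\<^sup>* b c))"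


section \<open>Well-definedness\<close>

lemma free_monoid_add:
  "a + b \<in> free_monoid G w \<longleftrightarrow> a \<in> free_monoid G w \<and> b \<in> free_monoid G w"
  by (auto simp: free_monoid_def)

lemma q_elem_in_free_monoid:
  "v \<in> verts G \<Longrightarrow> i \<le> num_weights G w v \<Longrightarrow> q_elem G w v i \<in> free_monoid G w"
  by (auto simp: free_monoid_def q_elem_def generators_def)

context weighted_graph
begin

lemma reduces_in_free_monoid:
  assumes "reduces G w a b"
  shows "a \<in> free_monoid G w" "b \<in> free_monoid G w"
proof -
  have vtx: "v \<in> verts G \<Longrightarrow> replicate_mset m (Vtx v) \<in> free_monoid G w" for v m
    by (auto simp: free_monoid_def generators_def split: if_splits)
  have rs: "range_sum G w v \<alpha> \<in> free_monoid G w" if "v \<in> verts G" for v \<alpha>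
  proof -
    have "finite {e \<in> out_arcs G v. w e = \<alpha>}" using row_finite[OF that] by (rule rev_finite_subset) auto
    then have "set_mset (range_sum G w v \<alpha>) = (\<lambda>e. Vtx (head G e)) ` {e \<in> out_arcs G v. w e = \<alpha>}"
      unfolding range_sum_def by (induction rule: finite_induct) auto
    then show ?thesis
      by (auto simp: free_monoid_def generators_def)
  qed
  show "a \<in> free_monoid G w" "b \<in> free_monoid G w"
    using assms
    by (auto elim!: reduces.cases simp: free_monoid_add vtx rs regular_def intro!: q_elem_in_free_monoid)
qed

lemma weighted_cong_in_free_monoid:
  "weighted_cong G w a b \<Longrightarrow> a \<in> free_monoid G w \<and> b \<in> free_monoid G w"
  by (induction rule: weighted_cong.induct) (auto simp: reduces_in_free_monoid free_monoid_add)

lemma equiv_cong_rel: "equiv (free_monoid G w) (cong_rel G w)"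
  by (rule equivI)
    (auto simp: cong_rel_def refl_on_def sym_def trans_def weighted_cong_in_free_monoid
          intro: weighted_cong.refl weighted_cong.sym weighted_cong.trans)

lemma class_eq_iff:
  assumes "a \<in> free_monoid G w" "b \<in> free_monoid G w"
  shows "cong_rel G w `` {a} = cong_rel G w `` {b} \<longleftrightarrow> weighted_cong G w a b"
  using eq_equiv_class_iff[OF equiv_cong_rel assms] by (simp add: cong_rel_def)

lemma mult_class:
  assumes "a \<in> free_monoid G w" "b \<in> free_monoid G w"
  shows "cong_rel G w `` {a} \<otimes>\<^bsub>weighted_graph_monoid G w\<^esub> cong_rel G w `` {b}
           = cong_rel G w `` {a + b}"
  using assms
  by (auto simp: weighted_graph_monoid_def cong_rel_def intro: weighted_cong.intros)

lemma comm_monoid_weighted_graph_monoid: "comm_monoid (weighted_graph_monoid G w)"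
proof -
  let ?M = "weighted_graph_monoid G w" and ?c = "\<lambda>a. cong_rel G w `` {a}"
  have carr: "x \<in> carrier ?M \<longleftrightarrow> (\<exists>a \<in> free_monoid G w. x = ?c a)" for x
    by (auto simp: weighted_graph_monoid_def quotient_def)
  have one: "\<one>\<^bsub>?M\<^esub> = ?c {#}" by (simp add: weighted_graph_monoid_def)
  have zero: "{#} \<in> free_monoid G w" by (simp add: free_monoid_def)
  show ?thesis
  proof (rule comm_monoidI)
    show "x \<otimes>\<^bsub>?M\<^esub> y \<in> carrier ?M" if "x \<in> carrier ?M" "y \<in> carrier ?M" for x y
      using that by (auto simp: carr mult_class free_monoid_add intro!: bexI[of _ "_ + _"])
    show "\<one>\<^bsub>?M\<^esub> \<in> carrier ?M"
      using one zero by (auto simp: carr)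
  qed (use one zero in \<open>auto simp: carr mult_class free_monoid_add ac_simps\<close>)
qed

end

end

theory Submission
  imports Defs "HOL-Library.Confluence"
begin

text \<open>
  All edges of a star graph start at \<open>u\<close>, so every reduction step acts at \<open>u\<close> and, since the heads of
  the edges are sinks, consumes copies of \<open>u\<close> without ever producing one.

  If all weights agree, there is a single rule, so a multiset has at most one successor. Then the
  reduction relation is confluent, and confluence of the reduction relation always implies the
  confluence property of the monoid, because reduction is compatible with addition
  (\<open>monoid_confluent_if_confluentp\<close>).

  If there are at least two weights \<open>w\<^sub>1 < w\<^sub>2\<close>, write \<open>q = q\<^sub>1\<close> and \<open>d = w\<^sub>2 - w\<^sub>1\<close>, and consider the
  critical pair of the first two rules at \<open>q + m u\<close> with \<open>m = max w\<^sub>1 d\<close>. The first rule leads to an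
  element with two copies of \<open>q\<close> and fewer than \<open>d\<close> copies of \<open>u\<close>. The second rule, the only one
  that consumes \<open>q\<close>, needs \<open>d\<close> copies of \<open>u\<close>, so all further reducts keep both copies of \<open>q\<close>. The
  second rule applied to \<open>q + m u\<close> leads to an element without \<open>q\<close> and with fewer than \<open>w\<^sub>1\<close> copies
  of \<open>u\<close>. The first rule, the only one that produces \<open>q\<close>, needs \<open>w\<^sub>1\<close> copies of \<open>u\<close>, so no further
  reduct contains \<open>q\<close>. Hence the two sides of the critical pair have no common reduct.
\<close>

section \<open>Confluence of the reduction relation\<close>

context weighted_graph
begin

lemma reduces_add:
  assumes "reduces G w a b" "c \<in> free_monoid G w"
  shows "reduces G w (a + c) (b + c)"
  using assms(1)
proof cases
  case (1 y v i)
  show ?thesis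
    using reduces.intros[of "y + c" G w v i] 1 assms(2) by (simp add: free_monoid_add ac_simps)
qed

lemma rtranclp_reduces_add:
  assumes "(reduces G w)\<^sup>*\<^sup>* a b" "c \<in> free_monoid G w"
  shows "(reduces G w)\<^sup>*\<^sup>* (a + c) (b + c)"
  using assms(1)
  by (induction rule: rtranclp_induct) (auto intro: reduces_add[OF _ assms(2)] rtranclp.rtrancl_into_rtrancl)

lemma rtranclp_reduces_in_free_monoid:
  assumes "(reduces G w)\<^sup>*\<^sup>* a b" "a \<in> free_monoid G w"
  shows "b \<in> free_monoid G w"
  using assms by (induction rule: rtranclp_induct) (auto dest: reduces_in_free_monoid)

lemma rtranclp_reduces_imp_cong:
  assumes "(reduces G w)\<^sup>*\<^sup>* a b" "a \<in> free_monoid G w"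
  shows "weighted_cong G w a b"
  using assms
  by (induction rule: rtranclp_induct) (auto intro: weighted_cong.refl weighted_cong.base weighted_cong.trans)

text \<open>
  Congruent elements have a common reduct because joinability is itself a congruence: transitivity
  is the Church-Rosser argument, and for sums the two joining reductions are carried out one after
  the other.
\<close>
lemma joinable_if_cong:
  assumes "confluentp (reduces G w)" "weighted_cong G w a b"
  shows "\<exists>c. (reduces G w)\<^sup>*\<^sup>* a c \<and> (reduces G w)\<^sup>*\<^sup>* b c"
  using assms(2)
proof (induction rule: weighted_cong.induct)
  case (trans a b c)
  from trans.IH obtain x y
    where x: "(reduces G w)\<^sup>*\<^sup>* a x" "(reduces G w)\<^sup>*\<^sup>* b x"
      and y: "(reduces G w)\<^sup>*\<^sup>* b y" "(reduces G w)\<^sup>*\<^sup>* c y" by blast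
  obtain z where "(reduces G w)\<^sup>*\<^sup>* x z" "(reduces G w)\<^sup>*\<^sup>* y z"
    using confluentpD[OF assms(1) x(2) y(1)] by blast
  with x y show ?case by (meson rtranclp_trans)
next
  case (add a b c d)
  from add.IH obtain x y
    where x: "(reduces G w)\<^sup>*\<^sup>* a x" "(reduces G w)\<^sup>*\<^sup>* b x"
      and y: "(reduces G w)\<^sup>*\<^sup>* c y" "(reduces G w)\<^sup>*\<^sup>* d y" by blast
  have mem: "a \<in> free_monoid G w" "c \<in> free_monoid G w" "d \<in> free_monoid G w"
    using add.hyps by (auto dest: weighted_cong_in_free_monoid)
  have xm: "x \<in> free_monoid G w"
    using x(1) mem(1) by (rule rtranclp_reduces_in_free_monoid)
  have "(reduces G w)\<^sup>*\<^sup>* (a + c) (x + y)"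
    using rtranclp_trans[OF rtranclp_reduces_add[OF x(1) mem(2)]]
      rtranclp_reduces_add[OF y(1) xm] by (simp add: add.commute)
  moreover have "(reduces G w)\<^sup>*\<^sup>* (b + d) (x + y)"
    using rtranclp_trans[OF rtranclp_reduces_add[OF x(2) mem(3)]]
      rtranclp_reduces_add[OF y(2) xm] by (simp add: add.commute)
  ultimately show ?case by blast
qed blast+

lemma monoid_confluent_if_confluentp:
  assumes "confluentp (reduces G w)"
  shows "monoid_confluent G w"
  unfolding monoid_confluent_def
  using joinable_if_cong[OF assms] rtranclp_reduces_in_free_monoid
  by (meson rtranclp_reduces_imp_cong weighted_cong.sym weighted_cong.trans)

section \<open>The distinct weights at a vertex\<close>

lemma weight_at_strict_mono:
  assumes v: "v \<in> verts G" and ij: "i < j" "j \<le> num_weights G w v"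
  shows "weight_at G w v i < weight_at G w v j"
proof -
  have fin: "finite (w ` out_arcs G v)"
    using row_finite[OF v] by simp
  have sorted: "sorted_wrt (<) (0 # sorted_list_of_set (w ` out_arcs G v))"
    using fin weight_pos by (fastforce simp: strict_sorted_list_of_set)
  have "j < length (0 # sorted_list_of_set (w ` out_arcs G v))"
    using ij by (simp add: num_weights_def)
  then show ?thesis
    unfolding weight_at_def by (rule sorted_wrt_nth_less[OF sorted ij(1)])
qed

lemma weight_at_0: "weight_at G w v 0 = 0"
  by (simp add: weight_at_def)

end

lemma count_range_sum_Q_gen: "count (range_sum G w v \<alpha>) (Q_gen x i) = 0"
  by (simp add: range_sum_def count_sum)

lemma count_q_elem_Vtx: "count (q_elem G w v i) (Vtx x) = 0"
  by (simp add: q_elem_def)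

section \<open>Reduction in star graphs\<close>

context weighted_star_graph
begin

lemma regular_imp_source:
  assumes "regular G v"
  shows "v = u"
  using assms tail_source by (auto simp: regular_def)

lemma count_range_sum_source: "count (range_sum G w v \<alpha>) (Vtx u) = 0"
  using head_S by (fastforce simp: range_sum_def count_sum)

lemma reduces_source_decreasing:
  assumes "reduces G w a b"
  shows "count b (Vtx u) \<le> count a (Vtx u)"
  using assms by cases (simp add: count_q_elem_Vtx count_range_sum_source)

text \<open>Only the second rule consumes \<open>q\<^sub>1\<close>, and it needs \<open>w\<^sub>2 - w\<^sub>1\<close> copies of \<open>u\<close>.\<close>
lemma reduces_keeps_q1:
  assumes "reduces G w a b"
    and "count a (Vtx u) < weight_at G w u 2 - weight_at G w u 1"
  shows "count a (Q_gen u 1) \<le> count b (Q_gen u 1)"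
  using assms(1)
proof cases
  case (1 y v i)
  have v: "v = u" using 1 regular_imp_source by blast
  have "i \<noteq> 2"
    using assms(2) 1 v by (auto simp: count_q_elem_Vtx numeral_2_eq_2)
  then have "count (q_elem G w u (i - 1)) (Q_gen u 1) = 0"
    using 1(5) by (auto simp: q_elem_def)
  then show ?thesis
    using 1 v by (simp add: count_range_sum_Q_gen)
qed

text \<open>Only the first rule produces \<open>q\<^sub>1\<close>, and it needs \<open>w\<^sub>1\<close> copies of \<open>u\<close>.\<close>
lemma reduces_creates_no_q1:
  assumes "reduces G w a b"
    and "count a (Vtx u) < weight_at G w u 1"
  shows "count b (Q_gen u 1) \<le> count a (Q_gen u 1)"
  using assms(1)
proof cases
  case (1 y v i)
  have v: "v = u" using 1 regular_imp_source by blast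
  have "i \<noteq> 1"
    using assms(2) 1 v by (auto simp: count_q_elem_Vtx weight_at_0)
  then have "count (q_elem G w u i) (Q_gen u 1) = 0"
    by (auto simp: q_elem_def)
  then show ?thesis
    using 1 v by (simp add: count_range_sum_Q_gen)
qed

lemma rtranclp_reduces_keeps_q1:
  assumes "(reduces G w)\<^sup>*\<^sup>* a b"
    and "count a (Vtx u) < weight_at G w u 2 - weight_at G w u 1"
  shows "count a (Q_gen u 1) \<le> count b (Q_gen u 1)"
  using assms
proof (induction rule: converse_rtranclp_induct)
  case (step a a')
  then show ?case
    using reduces_keeps_q1[of a a'] reduces_source_decreasing[of a a'] by linarith
qed simp

lemma rtranclp_reduces_creates_no_q1:
  assumes "(reduces G w)\<^sup>*\<^sup>* a b"
    and "count a (Vtx u) < weight_at G w u 1"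
  shows "count b (Q_gen u 1) \<le> count a (Q_gen u 1)"
  using assms
proof (induction rule: converse_rtranclp_induct)
  case (step a a')
  then show ?case
    using reduces_creates_no_q1[of a a'] reduces_source_decreasing[of a a'] by linarith
qed simp

lemma num_weights_ge_2_if_not_vertex_weighted:
  assumes "\<not> vertex_weighted G w"
  shows "regular G u" "2 \<le> num_weights G w u"
proof -
  obtain v e f where v: "regular G v" and ef: "e \<in> out_arcs G v" "f \<in> out_arcs G v" "w e \<noteq> w f"
    using assms by (auto simp: vertex_weighted_def)
  have [simp]: "v = u" using v by (rule regular_imp_source)
  show "regular G u" using v by simp
  have "card {w e, w f} \<le> card (w ` out_arcs G u)"
    using ef row_finite[OF source_in_verts] by (intro card_mono) auto
  then show "2 \<le> num_weights G w u"
    using ef(3) by (simp add: num_weights_def)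
qed

text \<open>
  The number of copies of \<open>q\<^sub>1\<close> separates the two sides of the critical pair of the first two rules:
  it stays at least \<open>2\<close> on one side and \<open>0\<close> on the other.
\<close>
lemma not_monoid_confluent_if_two_weights:
  assumes reg: "regular G u" and k: "2 \<le> num_weights G w u"
  shows "\<not> monoid_confluent G w"
proof
  assume conf: "monoid_confluent G w"
  define w1 where "w1 = weight_at G w u 1"
  define d where "d = weight_at G w u 2 - weight_at G w u 1"
  \<comment> \<open>The least number of copies of \<open>u\<close> for which both rules apply: each of them then leaves too few
    copies of \<open>u\<close> for the other one.\<close>
  define m where "m = max w1 d"
  define q where "q = {#Q_gen u 1#}"
  define x where "x = q + replicate_mset m (Vtx u)"
  define a where "a = q + replicate_mset (m - w1) (Vtx u) + q + range_sum G w u w1"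
  define b where
    "b = replicate_mset (m - d) (Vtx u) + q_elem G w u 2 + range_sum G w u (weight_at G w u 2)"
  have pos: "0 < w1" "0 < d"
    using weight_at_strict_mono[OF source_in_verts, of 0 1]
      weight_at_strict_mono[OF source_in_verts, of 1 2] k
    by (auto simp: w1_def d_def weight_at_0)
  have q: "q_elem G w u 1 = q" using k by (simp add: q_elem_def q_def)
  have u_mem: "replicate_mset j (Vtx u) \<in> free_monoid G w" for j
    using source_in_verts by (auto simp: free_monoid_def generators_def)
  have q_mem: "q \<in> free_monoid G w"
    using q_elem_in_free_monoid[OF source_in_verts, of 1 w] k q by simp
  have split: "replicate_mset m (Vtx u) = replicate_mset (m - j) (Vtx u) + replicate_mset j (Vtx u)"
    if "j \<le> m" for j
    using that by (auto simp: multiset_eq_iff)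
  have xa: "reduces G w x a"
    using reduces.intros[of "q + replicate_mset (m - w1) (Vtx u)" G w u 1] reg k q q_mem u_mem
      split[of w1]
    by (simp add: x_def a_def free_monoid_add weight_at_0 q_elem_def[of _ _ _ 0] m_def w1_def
        flip: add.assoc)
  have xb: "reduces G w x b"
    using reduces.intros[of "replicate_mset (m - d) (Vtx u)" G w u 2] reg k q u_mem
      split[of d] d_def
    by (simp add: x_def b_def m_def ac_simps)
  have "weighted_cong G w a b"
    using xa xb by (meson weighted_cong.intros)
  then obtain c where c: "(reduces G w)\<^sup>*\<^sup>* a c" "(reduces G w)\<^sup>*\<^sup>* b c"
    using conf xa xb by (metis monoid_confluent_def reduces_in_free_monoid(2))
  have "count a (Vtx u) = m - w1" "count a (Q_gen u 1) = 2"
    by (simp_all add: a_def q_def count_range_sum_source count_range_sum_Q_gen)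
  moreover have "m - w1 < d" using pos by (auto simp: m_def)
  ultimately have "2 \<le> count c (Q_gen u 1)"
    using rtranclp_reduces_keeps_q1[OF c(1)] by (simp add: d_def)
  moreover have "count c (Q_gen u 1) \<le> 0"
  proof -
    have "count b (Vtx u) = m - d" "count b (Q_gen u 1) = 0"
      by (simp_all add: b_def q_elem_def count_range_sum_source count_range_sum_Q_gen)
    moreover have "m - d < w1" using pos by (auto simp: m_def)
    ultimately show ?thesis
      using rtranclp_reduces_creates_no_q1[OF c(2)] by (simp add: w1_def)
  qed
  ultimately show False by simp
qed

text \<open>With a single weight at \<open>u\<close> only one rule remains, and its left-hand side determines the result.\<close>
lemma reduces_deterministic_if_vertex_weighted:
  assumes vw: "vertex_weighted G w" and ab: "reduces G w a b" and ac: "reduces G w a c"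
  shows "b = c"
proof -
  have shape: "\<exists>y. a = y + replicate_mset (weight_at G w u 1) (Vtx u) \<and>
      b = y + range_sum G w u (weight_at G w u 1)" if "reduces G w a b" for b
    using that
  proof cases
    case (1 y v i)
    have v: "v = u" using 1(4) by (rule regular_imp_source)
    obtain e where e: "e \<in> out_arcs G u" using 1(4) v unfolding regular_def by blast
    have "w f = w e" if "f \<in> out_arcs G u" for f
      using vw 1(4) v e that unfolding vertex_weighted_def by blast
    then have "w ` out_arcs G u = {w e}"
      using e by blast
    then have k: "num_weights G w u = 1" by (simp add: num_weights_def)
    then have "i = 1" using 1 v by simp
    then show ?thesis
      using 1 v k by (simp add: q_elem_def weight_at_0)
  qed
  show ?thesis using shape[OF ab] shape[OF ac] by (metis add_right_cancel)
qed

end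

theorem theorem3p21:
  fixes G :: "('v, 'e) pre_digraph" and w :: "'e \<Rightarrow> nat" and u :: 'v and n :: nat
  assumes "weighted_star_graph G w u n"
  shows "monoid_confluent G w \<longleftrightarrow> vertex_weighted G w"
proof
  interpret weighted_star_graph G w u n by fact
  show "vertex_weighted G w" if "monoid_confluent G w"
    using that num_weights_ge_2_if_not_vertex_weighted not_monoid_confluent_if_two_weights by blast
  show "monoid_confluent G w" if "vertex_weighted G w"
  proof (rule monoid_confluent_if_confluentp, rule strong_confluentp_imp_confluentp, rule strong_confluentpI)
    fix a b c
    assume "reduces G w a b" "reduces G w a c"
    then have "b = c" by (rule reduces_deterministic_if_vertex_weighted[OF that])
    then show "\<exists>z. (reduces G w)\<^sup>*\<^sup>* b z \<and> (reduces G w)\<^sup>=\<^sup>= c z" by blast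
  qed
qed

end
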